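(* Let $k\ge1$ and let $\phi=(\phi_1,\dots,\phi_k):\mathbb{D}^k\to\overline{\mathbb{D}}^k$ be an analytic map such that $C_\phi f=f\circ\phi$ defines a bounded operator $C_\phi:A^+(\mathbb{T}^k)\to A^+(\mathbb{T}^k)$. Then $C_\phi$ is an automorphism of $A^+(\mathbb{T}^k)$ (a bijective algebra homomorphism onto $A^+(\mathbb{T}^k)$) if and only if $\phi(z)=(\epsilon_1z_{\sigma(1)},\dots,\epsilon_kz_{\sigma(k)})$ for some permutation $\sigma$ of $\{1,\dots,k\}$ and some complex numbers $\epsilon_1,\dots,\epsilon_k$ of modulus $1$.
   Context: $A^+(\mathbb{T}^k)$ is the algebra of functions $f:\overline{\mathbb{D}}^k\to\mathbb{C}$ of the form $f(z)=\sum_{n_1,\dots,n_k\ge0}a(n_1,\dots,n_k)z_1^{n_1}\cdots z_k^{n_k}$ with $\|f\|_{A^+(\mathbb{T}^k)}=\sum|a(n_1,\dots,n_k)|<\infty$, a commutative unital Banach algebra under pointwise multiplication. *)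

theory Defs
  imports "HOL-Complex_Analysis.Complex_Analysis"
begin

text \<open>The dimension k is CARD('n) for a finite index type 'n (so k \<ge> 1 automatically).
  Points of the polydisc are vectors z :: complex ^ 'n; multi-indices are functions 'n \<Rightarrow> nat.\<close>

definition polydisc :: "(complex ^ 'n::finite) set" where
  "polydisc = {z. \<forall>i. norm (z $ i) < 1}"

definition cpolydisc :: "(complex ^ 'n::finite) set" where
  "cpolydisc = {z. \<forall>i. norm (z $ i) \<le> 1}"

definition monomial_pow :: "('n::finite \<Rightarrow> nat) \<Rightarrow> complex ^ 'n \<Rightarrow> complex" where
  "monomial_pow m z = (\<Prod>i\<in>UNIV. (z $ i) ^ m i)"

definition represents :: "(('n::finite \<Rightarrow> nat) \<Rightarrow> complex) \<Rightarrow> (complex ^ 'n \<Rightarrow> complex) \<Rightarrow> bool" where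
  "represents a f \<longleftrightarrow> (\<lambda>m. norm (a m)) summable_on UNIV \<and>
     (\<forall>z\<in>cpolydisc. f z = (\<Sum>\<^sub>\<infinity>m. a m * monomial_pow m z))"

text \<open>A^+(T^k): functions on the closed polydisc (normalised to be 0 outside it, so that
  each element is a unique HOL function) with absolutely summable Taylor coefficients.\<close>
definition Aplus :: "(complex ^ 'n::finite \<Rightarrow> complex) set" where
  "Aplus = {f. (\<exists>a. represents a f) \<and> (\<forall>z. z \<notin> cpolydisc \<longrightarrow> f z = 0)}"

definition Aplus_norm :: "(complex ^ 'n::finite \<Rightarrow> complex) \<Rightarrow> real" where
  "Aplus_norm f = Inf {(\<Sum>\<^sub>\<infinity>m. norm (a m)) | a. represents a f}"

definition Aplus_one :: "complex ^ 'n::finite \<Rightarrow> complex" where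
  "Aplus_one z = (if z \<in> cpolydisc then 1 else 0)"

text \<open>The composition operator C_phi f = f \<circ> phi, viewed as the (unique) element of A^+
  agreeing with f \<circ> phi on the open polydisc.\<close>
definition comp_op :: "(complex ^ 'n::finite \<Rightarrow> complex ^ 'n) \<Rightarrow>
    (complex ^ 'n \<Rightarrow> complex) \<Rightarrow> (complex ^ 'n \<Rightarrow> complex)" where
  "comp_op \<phi> f = (THE g. g \<in> Aplus \<and> (\<forall>z\<in>polydisc. g z = f (\<phi> z)))"

text \<open>Holomorphy of a map of several complex variables on an open set (Osgood's definition:
  continuous and holomorphic in each variable separately).\<close>
definition holomorphic_several :: "(complex ^ 'n::finite \<Rightarrow> complex ^ 'm::finite) \<Rightarrow>
    (complex ^ 'n) set \<Rightarrow> bool" where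
  "holomorphic_several \<phi> S \<longleftrightarrow> continuous_on S \<phi> \<and>
     (\<forall>z\<in>S. \<forall>i j. (\<lambda>w. \<phi> (\<chi> l. if l = i then w else z $ l) $ j) field_differentiable (at (z $ i)))"

definition comp_op_bounded :: "(complex ^ 'n::finite \<Rightarrow> complex ^ 'n) \<Rightarrow> bool" where
  "comp_op_bounded \<phi> \<longleftrightarrow>
     (\<forall>f\<in>Aplus. \<exists>g\<in>Aplus. \<forall>z\<in>polydisc. g z = f (\<phi> z)) \<and>
     (\<exists>C. \<forall>f\<in>Aplus. Aplus_norm (comp_op \<phi> f) \<le> C * Aplus_norm f)"

definition Aplus_automorphism :: "((complex ^ 'n::finite \<Rightarrow> complex) \<Rightarrow> (complex ^ 'n \<Rightarrow> complex)) \<Rightarrow> bool" where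
  "Aplus_automorphism T \<longleftrightarrow> bij_betw T Aplus Aplus \<and>
     (\<forall>f\<in>Aplus. \<forall>g\<in>Aplus. T (\<lambda>z. f z + g z) = (\<lambda>z. T f z + T g z)) \<and>
     (\<forall>c. \<forall>f\<in>Aplus. T (\<lambda>z. c * f z) = (\<lambda>z. c * T f z)) \<and>
     (\<forall>f\<in>Aplus. \<forall>g\<in>Aplus. T (\<lambda>z. f z * g z) = (\<lambda>z. T f z * T g z)) \<and>
     T Aplus_one = Aplus_one"

end

theory Submission
  imports Defs
begin

text \<open>
  Let \<open>T = C\<^sub>\<phi>\<close> be an automorphism and \<open>g\<^sub>i = T\<^sup>-\<^sup>1 z\<^sub>i\<close>. For \<open>|\<lambda>| > 1\<close> the function
  \<open>\<lambda> - g\<^sub>i\<close> is invertible because \<open>\<lambda> - z\<^sub>i\<close> is, so \<open>|g\<^sub>i| \<le> 1\<close> and \<open>g\<close> is a left inverse of \<open>\<phi>\<close> between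
  polydiscs. After moving \<open>\<phi> 0\<close> to 0 by disc automorphisms, the Schwarz lemma for \<open>\<phi>\<close> and \<open>g\<close> shows
  that for every \<open>i\<close> some component \<open>\<phi>\<^sub>j\<close> restricts to a Moebius map on the \<open>i\<close>-th coordinate axis.

  The powers of \<open>\<phi>\<^sub>j\<close> have bounded norm, which forces this Moebius map to be a rotation: on the
  \<open>Q\<close>-th roots of unity an \<open>\<ell>\<^sup>1\<close> bound on coefficients bounds the fourth moment of the discrete
  Fourier transform from below, while its average over all powers counts the solutions of a
  quadratic equation and is \<open>O(1/Q)\<close>.

  Finally \<open>\<phi>\<^sub>j\<close> is unimodular at the boundary points of the \<open>i\<close>-th axis, so by the maximum principle
  it does not depend on the remaining variables.
\<close>

subsection \<open>The algebra of absolutely convergent power series\<close>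

lemma norm_monomial_pow_le_1: "z \<in> cpolydisc \<Longrightarrow> norm (monomial_pow m z) \<le> 1"
  by (auto simp: monomial_pow_def cpolydisc_def norm_power prod_norm [symmetric]
      intro!: prod_le_1 power_le_one)

lemma polydisc_subset_cpolydisc: "polydisc \<subseteq> cpolydisc"
  by (auto simp: polydisc_def cpolydisc_def less_imp_le)

lemma zero_in_polydisc [simp]: "0 \<in> polydisc"
  by (simp add: polydisc_def)

lemma axis_in_polydisc_iff [simp]: "axis i x \<in> polydisc \<longleftrightarrow> norm x < 1"
  by (auto simp: polydisc_def axis_def split: if_splits)

lemma axis_in_cpolydisc_iff [simp]: "axis i x \<in> cpolydisc \<longleftrightarrow> norm x \<le> 1"
  by (auto simp: cpolydisc_def axis_def split: if_splits)

lemma monomial_pow_add: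
  "monomial_pow (\<lambda>i. p i + q i) z = monomial_pow p z * monomial_pow q z"
  by (simp add: monomial_pow_def power_add prod.distrib)

lemma monomial_pow_single:
  "monomial_pow (\<lambda>l. if l = i then n else 0) z = (z $ i) ^ n"
proof -
  have "monomial_pow (\<lambda>l. if l = i then n else 0) z =
      (\<Prod>l\<in>UNIV. if l = i then (z $ i) ^ n else 1)"
    unfolding monomial_pow_def by (intro prod.cong) auto
  then show ?thesis by simp
qed

lemma abs_summable_mult_monomial_pow:
  assumes "(\<lambda>k. norm (c k)) summable_on A" "z \<in> cpolydisc"
  shows "(\<lambda>k. norm (c k * monomial_pow (d k) z)) summable_on A"
  using assms(1)
  by (rule summable_on_comparison_test)
     (auto simp: norm_mult intro: mult_right_le_one_le norm_monomial_pow_le_1[OF assms(2)])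

lemma represents_has_sum:
  assumes "represents a f" "z \<in> cpolydisc"
  shows "((\<lambda>m. a m * monomial_pow m z) has_sum f z) UNIV"
proof -
  have "(\<lambda>m. a m * monomial_pow m z) summable_on UNIV"
    using assms abs_summable_mult_monomial_pow[of a UNIV z "\<lambda>m. m"]
    by (auto simp: represents_def intro: abs_summable_summable)
  then show ?thesis
    using assms by (auto simp: represents_def)
qed

text \<open>Repeated exponents are allowed here; the coefficient of a multi-index is the sum of the
  weights over the corresponding fibre.\<close>
lemma Aplus_familyI:
  fixes c :: "'b \<Rightarrow> complex" and d :: "'b \<Rightarrow> 'n::finite \<Rightarrow> nat"
  assumes summ: "(\<lambda>k. norm (c k)) summable_on UNIV"
    and f: "\<And>z. z \<in> cpolydisc \<Longrightarrow> ((\<lambda>k. c k * monomial_pow (d k) z) has_sum f z) UNIV"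
    and f0: "\<And>z. z \<notin> cpolydisc \<Longrightarrow> f z = 0"
  shows "f \<in> Aplus"
proof -
  define S where "S p = {k. d k = p}" for p
  define a where "a p = (\<Sum>\<^sub>\<infinity>k\<in>S p. c k)" for p
  \<comment> \<open>\<open>Sigma UNIV S\<close> pairs every index with its exponent, so sums over it
    are the original sums, and they can be evaluated fibre by fibre.\<close>
  have bij: "bij_betw snd (Sigma UNIV S) UNIV"
    by (rule bij_betwI[where g = "\<lambda>k. (d k, k)"]) (auto simp: S_def)
  have summS: "(\<lambda>k. norm (c k)) summable_on S p" for p
    using summ by (rule summable_on_subset_banach) auto
  have summS': "c summable_on S p" for p
    using summS by (rule abs_summable_summable)
  have "(\<lambda>x. norm (c (snd x))) summable_on Sigma UNIV S"
    using summable_on_reindex_bij_betw[OF bij, of "\<lambda>k. norm (c k)"] summ by simp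
  then have "(\<lambda>p. \<Sum>\<^sub>\<infinity>k\<in>S p. norm (c k)) summable_on UNIV"
    using summable_on_SigmaD[of "\<lambda>x. norm (c (snd x))" UNIV S] summS by simp
  then have A: "(\<lambda>p. norm (a p)) summable_on UNIV"
    by (rule summable_on_comparison_test) (auto simp: a_def summS intro!: norm_infsum_bound)
  have "f z = (\<Sum>\<^sub>\<infinity>p. a p * monomial_pow p z)" if z: "z \<in> cpolydisc" for z
  proof -
    have 1: "((\<lambda>x. c (snd x) * monomial_pow (d (snd x)) z) has_sum f z) (Sigma UNIV S)"
      using has_sum_reindex_bij_betw[OF bij, of "\<lambda>k. c k * monomial_pow (d k) z"] f[OF z] by simp
    have 2: "((\<lambda>k. c k * monomial_pow (d k) z) has_sum (a p * monomial_pow p z)) (S p)" for p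
    proof -
      have "((\<lambda>k. c k * monomial_pow p z) has_sum (a p * monomial_pow p z)) (S p)"
        unfolding a_def by (intro has_sum_cmult_left has_sum_infsum summS')
      then show ?thesis
        by (rule has_sum_cong[THEN iffD1, rotated]) (auto simp: S_def)
    qed
    show ?thesis
      using has_sum_SigmaD[OF 1, of "\<lambda>p. a p * monomial_pow p z"] 2 by (simp add: infsumI)
  qed
  with A f0 show ?thesis
    by (auto simp: Aplus_def represents_def)
qed

lemma AplusE:
  assumes "f \<in> Aplus"
  obtains a where "(\<lambda>m. norm (a m)) summable_on UNIV"
    and "\<And>z. z \<in> cpolydisc \<Longrightarrow> ((\<lambda>m. a m * monomial_pow m z) has_sum f z) UNIV"
    and "\<And>z. z \<notin> cpolydisc \<Longrightarrow> f z = 0"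
  using assms represents_has_sum unfolding Aplus_def by (auto simp: represents_def)

lemma Aplus_add:
  assumes "f \<in> Aplus" "g \<in> Aplus"
  shows "(\<lambda>z. f z + g z) \<in> Aplus"
proof -
  obtain a where a: "(\<lambda>m. norm (a m)) summable_on UNIV"
    "\<And>z. z \<in> cpolydisc \<Longrightarrow> ((\<lambda>m. a m * monomial_pow m z) has_sum f z) UNIV"
    "\<And>z. z \<notin> cpolydisc \<Longrightarrow> f z = 0"
    using AplusE[OF assms(1)] by blast
  obtain b where b: "(\<lambda>m. norm (b m)) summable_on UNIV"
    "\<And>z. z \<in> cpolydisc \<Longrightarrow> ((\<lambda>m. b m * monomial_pow m z) has_sum g z) UNIV"
    "\<And>z. z \<notin> cpolydisc \<Longrightarrow> g z = 0"
    using AplusE[OF assms(2)] by blast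
  show ?thesis
  proof (rule Aplus_familyI[where c = "\<lambda>m. a m + b m" and d = "\<lambda>m. m"])
    show "(\<lambda>m. norm (a m + b m)) summable_on UNIV"
      by (rule summable_on_comparison_test[OF summable_on_add[OF a(1) b(1)]])
         (auto intro: norm_triangle_ineq)
    show "((\<lambda>m. (a m + b m) * monomial_pow m z) has_sum (f z + g z)) UNIV"
      if "z \<in> cpolydisc" for z
      using has_sum_add[OF a(2)[OF that] b(2)[OF that]] by (simp add: distrib_right)
  qed (use a b in auto)
qed

lemma Aplus_cmult:
  assumes "f \<in> Aplus"
  shows "(\<lambda>z. c * f z) \<in> Aplus"
proof -
  obtain a where a: "(\<lambda>m. norm (a m)) summable_on UNIV"
    "\<And>z. z \<in> cpolydisc \<Longrightarrow> ((\<lambda>m. a m * monomial_pow m z) has_sum f z) UNIV"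
    "\<And>z. z \<notin> cpolydisc \<Longrightarrow> f z = 0"
    using AplusE[OF assms] by blast
  show ?thesis
  proof (rule Aplus_familyI[where c = "\<lambda>m. c * a m" and d = "\<lambda>m. m"])
    show "(\<lambda>m. norm (c * a m)) summable_on UNIV"
      by (simp add: norm_mult summable_on_cmult_right a(1))
    show "((\<lambda>m. c * a m * monomial_pow m z) has_sum (c * f z)) UNIV"
      if "z \<in> cpolydisc" for z
      using has_sum_cmult_right[OF a(2)[OF that], of c] by (simp add: mult.assoc)
  qed (use a in auto)
qed

text \<open>The product series is indexed by pairs of multi-indices with repeated exponents;
  \<open>Aplus_familyI\<close> collects it into the Cauchy product.\<close>

lemma Aplus_mult:
  assumes "f \<in> Aplus" "g \<in> Aplus"
  shows "(\<lambda>z. f z * g z) \<in> Aplus"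
proof -
  obtain a where a: "(\<lambda>m. norm (a m)) summable_on UNIV"
    "\<And>z. z \<in> cpolydisc \<Longrightarrow> ((\<lambda>m. a m * monomial_pow m z) has_sum f z) UNIV"
    "\<And>z. z \<notin> cpolydisc \<Longrightarrow> f z = 0"
    using AplusE[OF assms(1)] by blast
  obtain b where b: "(\<lambda>m. norm (b m)) summable_on UNIV"
    "\<And>z. z \<in> cpolydisc \<Longrightarrow> ((\<lambda>m. b m * monomial_pow m z) has_sum g z) UNIV"
    "\<And>z. z \<notin> cpolydisc \<Longrightarrow> g z = 0"
    using AplusE[OF assms(2)] by blast
  let ?c = "\<lambda>k. a (fst k) * b (snd k)" and ?d = "\<lambda>k i. fst k i + snd k i"
  have summ: "(\<lambda>k. norm (?c k)) summable_on UNIV \<times> UNIV"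
  proof (rule summable_on_SigmaI[where g = "\<lambda>m. norm (a m) * (\<Sum>\<^sub>\<infinity>l. norm (b l))"])
    show "((\<lambda>y. norm (a (fst (x, y)) * b (snd (x, y)))) has_sum
        norm (a x) * (\<Sum>\<^sub>\<infinity>l. norm (b l))) UNIV" for x
      using has_sum_cmult_right[OF has_sum_infsum[OF b(1)]] by (simp add: norm_mult)
  qed (auto intro: summable_on_cmult_left a)
  show ?thesis
  proof (rule Aplus_familyI[where c = ?c and d = ?d])
    show "(\<lambda>k. norm (?c k)) summable_on UNIV"
      using summ by simp
    show "((\<lambda>k. ?c k * monomial_pow (?d k) z) has_sum (f z * g z)) UNIV"
      if z: "z \<in> cpolydisc" for z
    proof -
      have "((\<lambda>k. ?c k * monomial_pow (?d k) z) has_sum (f z * g z)) (UNIV \<times> UNIV)"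
      proof (rule has_sum_SigmaI)
        show "((\<lambda>m. a m * monomial_pow m z * g z) has_sum (f z * g z)) UNIV"
          by (rule has_sum_cmult_left[OF a(2)[OF z]])
        show "((\<lambda>y. ?c (x, y) * monomial_pow (?d (x, y)) z) has_sum
            (a x * monomial_pow x z * g z)) UNIV" for x
          using has_sum_cmult_right[OF b(2)[OF z], of "a x * monomial_pow x z"]
          by (simp add: monomial_pow_add mult_ac)
        show "(\<lambda>k. ?c k * monomial_pow (?d k) z) summable_on UNIV \<times> UNIV"
          by (rule abs_summable_summable, rule abs_summable_mult_monomial_pow[OF summ z])
      qed
      then show ?thesis by simp
    qed
  qed (use a in auto)
qed

text \<open>Cut off outside the closed polydisc to match the normalisation of \<open>Aplus\<close>;
  \<open>n = 1\<close> is the coordinate function.\<close>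

definition Aplus_monomial :: "'n::finite \<Rightarrow> nat \<Rightarrow> complex ^ 'n \<Rightarrow> complex" where
  "Aplus_monomial i n z = (if z \<in> cpolydisc then (z $ i) ^ n else 0)"

lemma represents_Aplus_monomial:
  "represents (\<lambda>m. if m = (\<lambda>l. if l = i then n else 0) then 1 else 0) (Aplus_monomial i n)"
    (is "represents (\<lambda>m. if m = ?p then 1 else 0) _")
proof -
  have "((\<lambda>m. (if m = ?p then 1 else 0) * monomial_pow m z) has_sum (z $ i) ^ n) UNIV" for z
    by (rule has_sum_finite_neutralI[where B = "{?p}"]) (auto simp: monomial_pow_single)
  moreover have "(\<lambda>m. norm (if m = ?p then 1 else 0 :: complex)) summable_on UNIV"
    by (rule finite_nonzero_values_imp_summable_on) auto
  ultimately show ?thesis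
    by (auto simp: represents_def Aplus_monomial_def intro!: infsumI[symmetric])
qed

lemma Aplus_monomial_in_Aplus [simp]: "Aplus_monomial i n \<in> Aplus"
  using represents_Aplus_monomial[of i n] by (auto simp: Aplus_def Aplus_monomial_def)

section \<open>Norm estimates and the resolvent of a coordinate\<close>

lemma Aplus_norm_le:
  assumes "represents a f"
  shows "Aplus_norm f \<le> (\<Sum>\<^sub>\<infinity>m. norm (a m))"
  unfolding Aplus_norm_def
  by (rule cInf_lower) (use assms in \<open>auto intro!: bdd_belowI[of _ 0] infsum_nonneg\<close>)

lemma Aplus_norm_nonneg: "f \<in> Aplus \<Longrightarrow> Aplus_norm f \<ge> 0"
  unfolding Aplus_norm_def
  by (rule cInf_greatest) (auto simp: Aplus_def intro!: infsum_nonneg)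

lemma Aplus_norm_monomial_le_1: "Aplus_norm (Aplus_monomial i n) \<le> 1"
proof -
  let ?p = "\<lambda>l. if l = i then n else 0"
  have "((\<lambda>m. norm (if m = ?p then 1 else 0 :: complex)) has_sum 1) UNIV"
    by (rule has_sum_finite_neutralI[where B = "{?p}"]) auto
  then show ?thesis
    using Aplus_norm_le[OF represents_Aplus_monomial[of i n]] by (simp add: infsumI)
qed

text \<open>The norm is an infimum over representing families, so a strict bound yields one concrete
  family.\<close>

lemma Aplus_norm_lessE:
  assumes "f \<in> Aplus" "Aplus_norm f < K"
  obtains a where "represents a f" "(\<Sum>\<^sub>\<infinity>m. norm (a m)) < K"
proof -
  have "{(\<Sum>\<^sub>\<infinity>m. norm (a m)) | a. represents a f} \<noteq> {}"
    using assms(1) by (auto simp: Aplus_def)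
  from cInf_lessD[OF this] assms(2) that show ?thesis
    unfolding Aplus_norm_def by blast
qed

lemma Aplus_one_eq: "Aplus_one = Aplus_monomial i 0"
  by (auto simp: Aplus_one_def Aplus_monomial_def)

lemma Aplus_one_in_Aplus [simp]: "Aplus_one \<in> Aplus"
  \<comment> \<open>With exponent 0 every index gives the same monomial, so \<open>undefined\<close>
    is just some index.\<close>
  by (subst Aplus_one_eq[of undefined]) simp

text \<open>The geometric series has absolutely summable coefficients because
  \<open>norm l > 1\<close>. It inverts \<open>l - z $ i\<close> inside the algebra, as the spectral
  argument requires.\<close>

lemma Aplus_resolvent:
  fixes i :: "'n::finite"
  assumes "norm l > 1"
  shows "(\<lambda>z. if z \<in> cpolydisc then inverse (l - z $ i) else 0) \<in> Aplus"
proof (rule Aplus_familyI[where c = "\<lambda>n::nat. inverse l ^ Suc n"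
      and d = "\<lambda>n l. if l = i then n else 0"])
  have l: "norm (inverse l) < 1" "l \<noteq> 0"
    using assms by (auto simp: norm_inverse inverse_less_1_iff)
  have "summable (\<lambda>n. norm (inverse l) ^ Suc n)"
    using l(1) by (simp add: summable_mult)
  then show "(\<lambda>n. norm (inverse l ^ Suc n)) summable_on UNIV"
    by (simp add: norm_power norm_mult summable_on_UNIV_nonneg_real_iff)
  fix z :: "complex ^ 'n" assume z: "z \<in> cpolydisc"
  then have zi: "norm (z $ i) \<le> 1" by (simp add: cpolydisc_def)
  define q where "q = inverse l * z $ i"
  have q: "norm q < 1"
    using l(1) zi mult_right_le_one_le[of "norm (inverse l)" "norm (z $ i)"]
    by (simp add: q_def norm_mult)
  have ne: "l \<noteq> z $ i" using zi assms by auto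
  have "((\<lambda>n. q ^ n) has_sum (1 / (1 - q))) UNIV"
    using q by (intro norm_summable_imp_has_sum geometric_sums) (auto simp: norm_power)
  then have "((\<lambda>n. inverse l * q ^ n) has_sum (inverse l * (1 / (1 - q)))) UNIV"
    by (rule has_sum_cmult_right)
  moreover have "inverse l * (1 / (1 - q)) = inverse (l - z $ i)"
    using l ne by (simp add: q_def field_simps)
  ultimately show "((\<lambda>n. inverse l ^ Suc n * monomial_pow (\<lambda>l. if l = i then n else 0) z) has_sum
      (if z \<in> cpolydisc then inverse (l - z $ i) else 0)) UNIV"
    using z by (simp add: monomial_pow_single q_def power_mult_distrib mult_ac)
qed auto

text \<open>Weierstrass M-test with majorants \<open>norm (a m)\<close>. The map \<open>c\<close>
  lets one statement serve both continuity and holomorphy along curves.\<close>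

lemma Aplus_uniform_limit:
  assumes "represents a f" "\<And>x. x \<in> S \<Longrightarrow> c x \<in> cpolydisc"
  shows "uniform_limit S (\<lambda>X x. \<Sum>m\<in>X. a m * monomial_pow m (c x)) (\<lambda>x. f (c x))
    (finite_subsets_at_top UNIV)"
proof (rule Weierstrass_m_test_general')
  show "norm (a m * monomial_pow m (c x)) \<le> norm (a m)" if "x \<in> S" for m x
    by (simp add: norm_mult mult_right_le_one_le norm_monomial_pow_le_1 assms that)
  show "((\<lambda>m. a m * monomial_pow m (c x)) has_sum f (c x)) UNIV" if "x \<in> S" for x
    by (rule represents_has_sum[OF assms(1) assms(2)[OF that]])
qed (use assms(1) in \<open>auto simp: represents_def\<close>)

lemma continuous_on_Aplus:
  assumes "f \<in> Aplus"
  shows "continuous_on cpolydisc f"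
proof -
  obtain a where a: "represents a f" using assms by (auto simp: Aplus_def)
  show ?thesis
    by (rule uniform_limit_theorem[OF _ Aplus_uniform_limit[OF a]])
       (auto simp: monomial_pow_def intro!: always_eventually continuous_intros)
qed

text \<open>Reduces several variables to one: the partial sums along the analytic curve
  \<open>c\<close> are holomorphic and converge uniformly.\<close>

lemma holomorphic_on_Aplus_compose:
  fixes c :: "complex \<Rightarrow> complex ^ 'n::finite"
  assumes "f \<in> Aplus" "open S" "\<And>x. x \<in> S \<Longrightarrow> c x \<in> cpolydisc"
    and "\<And>l. (\<lambda>x. c x $ l) holomorphic_on S"
  shows "(\<lambda>x. f (c x)) holomorphic_on S"
proof -
  obtain a where a: "represents a f" using assms by (auto simp: Aplus_def)
  have ul: "uniform_limit S (\<lambda>X x. \<Sum>m\<in>X. a m * monomial_pow m (c x)) (\<lambda>x. f (c x))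
      (finite_subsets_at_top UNIV)"
    by (rule Aplus_uniform_limit[OF a assms(3)])
  have "(\<lambda>x. f (c x)) field_differentiable at x" if "x \<in> S" for x
  proof -
    obtain r where r: "r > 0" "cball x r \<subseteq> S"
      using assms(2) \<open>x \<in> S\<close> by (meson open_contains_cball)
    have hol: "(\<lambda>x. \<Sum>m\<in>X. a m * monomial_pow m (c x)) holomorphic_on S" for X
      unfolding monomial_pow_def by (intro holomorphic_intros assms(4))
    have "(\<lambda>x. f (c x)) holomorphic_on ball x r"
    proof (rule holomorphic_uniform_limit[OF _ uniform_limit_on_subset[OF ul r(2)]])
      show "\<forall>\<^sub>F X in finite_subsets_at_top UNIV.
          continuous_on (cball x r) (\<lambda>x. \<Sum>m\<in>X. a m * monomial_pow m (c x)) \<and>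
          (\<lambda>x. \<Sum>m\<in>X. a m * monomial_pow m (c x)) holomorphic_on ball x r"
        using r(2) ball_subset_cball[of x r]
        by (intro always_eventually allI conjI holomorphic_on_imp_continuous_on
            holomorphic_on_subset[OF hol]) auto
    qed auto
    then show ?thesis
      using r(1) by (auto simp: holomorphic_on_open field_differentiable_def)
  qed
  then show ?thesis
    by (auto simp: holomorphic_on_def intro: field_differentiable_at_within)
qed

subsection \<open>Powers of Moebius maps\<close>

text \<open>For \<open>norm a < 1\<close>, the automorphism of the unit disc that sends
  \<open>a\<close> to 0; its inverse is \<open>disc_moebius (- a)\<close>.\<close>

definition disc_moebius :: "complex \<Rightarrow> complex \<Rightarrow> complex" where
  "disc_moebius a z = (z - a) / (1 - cnj a * z)"

lemma moebius_denom_nonzero: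
  assumes "norm a < 1" "norm z \<le> 1"
  shows "1 - cnj a * z \<noteq> 0"
proof
  assume "1 - cnj a * z = 0"
  then have "norm (cnj a * z) = 1" by simp
  moreover have "norm (cnj a * z) \<le> norm a"
    using assms by (simp add: norm_mult mult_right_le_one_le)
  ultimately show False using assms by simp
qed

text \<open>The sign of the right-hand side compares numerator and denominator of
  \<open>disc_moebius a z\<close>, both inside the disc and on the circle.\<close>

lemma moebius_norm_identity:
  "(norm (1 - cnj a * z))\<^sup>2 - (norm (z - a))\<^sup>2 = (1 - (norm a)\<^sup>2) * (1 - (norm z)\<^sup>2)"
proof -
  have "complex_of_real ((norm (1 - cnj a * z))\<^sup>2 - (norm (z - a))\<^sup>2) =
      complex_of_real ((1 - (norm a)\<^sup>2) * (1 - (norm z)\<^sup>2))"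
    by (simp only: of_real_diff of_real_mult complex_norm_square of_real_1) (simp add: algebra_simps)
  then show ?thesis by (simp only: of_real_eq_iff)
qed

lemma norm_moebius_le_1:
  assumes "norm a < 1" "norm z \<le> 1"
  shows "norm (disc_moebius a z) \<le> 1"
proof -
  have "(1 - (norm a)\<^sup>2) * (1 - (norm z)\<^sup>2) \<ge> 0"
    using assms by (intro mult_nonneg_nonneg) (auto simp: power_le_one abs_square_le_1)
  then have "(norm (z - a))\<^sup>2 \<le> (norm (1 - cnj a * z))\<^sup>2"
    using moebius_norm_identity[of a z] by linarith
  then have "norm (z - a) \<le> norm (1 - cnj a * z)"
    by (rule power2_le_imp_le) simp
  then show ?thesis
    by (simp add: disc_moebius_def norm_divide divide_le_eq_1)
qed

lemma norm_moebius_eq_1: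
  assumes "norm a < 1" "norm z = 1"
  shows "norm (disc_moebius a z) = 1"
proof -
  have "(norm (z - a))\<^sup>2 = (norm (1 - cnj a * z))\<^sup>2"
    using moebius_norm_identity[of a z] assms(2) by simp
  then have "norm (z - a) = norm (1 - cnj a * z)"
    by simp
  then show ?thesis
    using moebius_denom_nonzero[of a z] assms by (simp add: disc_moebius_def norm_divide)
qed

lemma moebius_self [simp]: "disc_moebius a a = 0"
  by (simp add: disc_moebius_def)

lemma moebius_zero [simp]: "disc_moebius a 0 = - a" "disc_moebius 0 z = z"
  by (simp_all add: disc_moebius_def)

lemma moebius_uminus_moebius:
  assumes "norm a < 1" "norm z \<le> 1"
  shows "disc_moebius (- a) (disc_moebius a z) = z"
proof -
  have d: "1 - cnj a * z \<noteq> 0" "1 - cnj a * a \<noteq> 0"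
    using moebius_denom_nonzero assms by auto
  have "disc_moebius (- a) (disc_moebius a z) =
      ((z - a) / (1 - cnj a * z) + a) / (1 + cnj a * ((z - a) / (1 - cnj a * z)))"
    by (simp add: disc_moebius_def)
  also have "(z - a) / (1 - cnj a * z) + a = z * (1 - cnj a * a) / (1 - cnj a * z)"
    using d(1) by (simp add: field_simps)
  also have "1 + cnj a * ((z - a) / (1 - cnj a * z)) = (1 - cnj a * a) / (1 - cnj a * z)"
    using d(1) by (simp add: field_simps)
  finally show ?thesis using d by simp
qed

lemma holomorphic_on_moebius:
  assumes "norm a < 1" "f holomorphic_on S" "\<And>x. x \<in> S \<Longrightarrow> norm (f x) \<le> 1"
  shows "(\<lambda>x. disc_moebius a (f x)) holomorphic_on S"
  unfolding disc_moebius_def using assms moebius_denom_nonzero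
  by (intro holomorphic_intros) auto

text \<open>With the product \<open>x y\<close> held fixed, \<open>disc_moebius a x * disc_moebius a y\<close> is a fractional linear
  function of \<open>x + y\<close>, and it degenerates only if \<open>cnj a * (x * y) = a\<close>.\<close>
lemma moebius_mult_eq_cases:
  assumes a: "norm a < 1" and u: "norm x = 1" "norm y = 1" "norm z = 1" "norm w = 1"
    and P: "x * y = z * w"
    and eq: "disc_moebius a x * disc_moebius a y = disc_moebius a z * disc_moebius a w"
  shows "x = z \<or> x = w \<or> cnj a * (x * y) = a"
proof -
  define p s t where "p = x * y" and "s = x + y" and "t = z + w"
  have d: "1 - cnj a * x \<noteq> 0" "1 - cnj a * y \<noteq> 0" "1 - cnj a * z \<noteq> 0" "1 - cnj a * w \<noteq> 0"
    "1 - cnj a * a \<noteq> 0"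
    by (rule moebius_denom_nonzero; use a u in simp)+
  have "((x - a) * (y - a)) * ((1 - cnj a * z) * (1 - cnj a * w)) =
      ((z - a) * (w - a)) * ((1 - cnj a * x) * (1 - cnj a * y))"
    using eq d(1-4) by (simp add: disc_moebius_def frac_eq_eq)
  moreover have "(x - a) * (y - a) = p - a * s + a * a" "(z - a) * (w - a) = p - a * t + a * a"
    "(1 - cnj a * z) * (1 - cnj a * w) = 1 - cnj a * t + cnj a * cnj a * p"
    "(1 - cnj a * x) * (1 - cnj a * y) = 1 - cnj a * s + cnj a * cnj a * p"
    using P by (auto simp: p_def s_def t_def algebra_simps)
  ultimately have "(p - a * s + a * a) * (1 - cnj a * t + cnj a * cnj a * p) =
      (p - a * t + a * a) * (1 - cnj a * s + cnj a * cnj a * p)"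
    by simp
  then have "(s - t) * ((1 - cnj a * a) * (cnj a * p - a)) = 0"
    by (simp add: algebra_simps)
  then have "s = t \<or> cnj a * p = a"
    using d(5) by simp
  moreover have "x = z \<or> x = w" if "s = t"
  proof -
    \<comment> \<open>With equal sums and products, \<open>x\<close> is a root of the quadratic with
      roots \<open>z\<close> and \<open>w\<close>.\<close>
    have "(x - z) * (x - w) = x * x - x * t + z * w"
      by (simp add: t_def algebra_simps)
    also have "\<dots> = x * x - x * s + p"
      using that P by (simp add: p_def)
    also have "\<dots> = 0"
      by (simp add: s_def p_def algebra_simps)
    finally show ?thesis by simp
  qed
  ultimately show ?thesis by (auto simp: p_def)
qed

section \<open>Fourth moments on roots of unity\<close>

lemma power_mean_tendsto:
  fixes w :: complex
  assumes "norm w = 1"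
  shows "(\<lambda>N. (\<Sum>n<N. w ^ n) / of_nat N) \<longlonglongrightarrow> (if w = 1 then 1 else 0)"
proof (cases "w = 1")
  case True
  have "(\<lambda>N. of_nat N / of_nat N :: complex) \<longlonglongrightarrow> 1"
    by (rule tendsto_eventually) (auto simp: eventually_at_top_linorder intro!: exI[of _ 1])
  with True show ?thesis by simp
next
  case False
  \<comment> \<open>For \<open>w\<close> other than 1 the geometric sums stay bounded, so dividing
    by \<open>N\<close> sends the means to 0.\<close>
  have b: "norm ((\<Sum>n<N. w ^ n) / of_nat N) \<le> 2 / norm (1 - w) * inverse (real N)" for N
  proof -
    have "norm (1 - w ^ N) \<le> 2"
      using norm_triangle_ineq4[of 1 "w ^ N"] assms by (simp add: norm_power)
    then have "norm (1 - w ^ N) / norm (1 - w) * inverse (real N) \<le>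
        2 / norm (1 - w) * inverse (real N)"
      by (intro mult_right_mono divide_right_mono) auto
    then show ?thesis
      using False by (simp add: sum_gp_strict norm_divide norm_mult norm_inverse divide_inverse)
  qed
  have "(\<lambda>N. 2 / norm (1 - w) * inverse (real N)) \<longlonglongrightarrow> 2 / norm (1 - w) * 0"
    by (intro tendsto_intros lim_inverse_n)
  then have "(\<lambda>N. (\<Sum>n<N. w ^ n) / of_nat N) \<longlonglongrightarrow> 0"
    by (intro Lim_null_comparison[OF always_eventually[OF allI[OF b]]]) simp
  with False show ?thesis by simp
qed

lemma norm_root_of_unity:
  fixes x :: complex
  assumes "x ^ n = 1" "n > 0"
  shows "norm x = 1"
proof -
  have "norm x ^ n = 1" using assms(1) by (simp flip: norm_power)
  then show ?thesis using assms(2) power_eq_iff_eq_base[of n "norm x" 1] by simp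
qed

lemma has_sum_sum:
  fixes f :: "'a \<Rightarrow> 'b \<Rightarrow> 'c::topological_comm_monoid_add"
  assumes "finite G" "\<And>x. x \<in> G \<Longrightarrow> ((\<lambda>k. f x k) has_sum s x) A"
  shows "((\<lambda>k. \<Sum>x\<in>G. f x k) has_sum (\<Sum>x\<in>G. s x)) A"
  using assms by (induction rule: finite_induct) (auto intro: has_sum_add)

text \<open>Up to normalisation the sum on the right is the sum of the fourth powers of the discrete
  Fourier coefficients of \<open>f\<close>; their squares sum to 1 and their moduli to at most \<open>K\<close>.\<close>
lemma fourth_moment_lower_bound:
  fixes f :: "complex \<Rightarrow> complex" and c :: "'b \<Rightarrow> complex" and d :: "'b \<Rightarrow> nat"
  assumes Q: "Q > 0" and G_def: "G = {x::complex. x ^ Q = 1}"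
    and unimod: "\<And>x. x \<in> G \<Longrightarrow> norm (f x) = 1"
    and summ: "(\<lambda>k. norm (c k)) summable_on UNIV" and le: "(\<Sum>\<^sub>\<infinity>k. norm (c k)) \<le> K"
    and f: "\<And>x. x \<in> G \<Longrightarrow> ((\<lambda>k. c k * x ^ d k) has_sum f x) UNIV"
  shows "real Q ^ 3 \<le> K ^ 4 * (\<Sum>u\<in>G. (norm (\<Sum>y\<in>G. cnj (f (u * y)) * f y))\<^sup>2)"
proof -
  \<comment> \<open>\<open>D\<close> is the autocorrelation of \<open>f\<close> on the group
    \<open>G\<close>. Its Fourier transform is the squared modulus of \<open>S\<close>, whose values
    are Fourier coefficients of \<open>f\<close> up to conjugation and scaling.\<close>
  define D where "D u = (\<Sum>y\<in>G. cnj (f (u * y)) * f y)" for u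
  define S where "S l = (\<Sum>x\<in>G. x ^ l * cnj (f x))" for l :: nat
  define W where "W = (\<Sum>u\<in>G. (norm (D u))\<^sup>2)"
  have finG: "finite G" and cardG: "card G = Q"
    using Q by (auto simp: G_def card_roots_unity_eq intro!: finite_roots_unity)
  have normG: "norm x = 1" if "x \<in> G" for x
    using that Q norm_root_of_unity[of x Q] by (simp add: G_def)
  have W0: "W \<ge> 0" unfolding W_def by (intro sum_nonneg) auto
  have K0: "K \<ge> 0" using le infsum_nonneg[of UNIV "\<lambda>k. norm (c k)"] by simp
  have S2: "(norm (S l))\<^sup>2 \<le> (\<Sum>u\<in>G. norm (D u))" for l
  proof -
    have "complex_of_real ((norm (S l))\<^sup>2) = S l * cnj (S l)"
      by (rule complex_norm_square)
    also have "\<dots> = (\<Sum>y\<in>G. \<Sum>x\<in>G. x ^ l * cnj (f x) * (cnj y ^ l * f y))"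
      unfolding S_def cnj_sum sum_product by (subst sum.swap) simp
    also have "\<dots> = (\<Sum>y\<in>G. \<Sum>u\<in>G. u ^ l * (cnj (f (u * y)) * f y))"
    proof (rule sum.cong[OF refl])
      fix y assume y: "y \<in> G"
      have y0: "y \<noteq> 0" and yy: "y * cnj y = 1"
        using normG[OF y] by (auto simp: complex_norm_square[symmetric])
      \<comment> \<open>Substitute \<open>x = u * y\<close> in the group; the powers of
        \<open>y\<close> then cancel against those of \<open>cnj y\<close>.\<close>
      have "(\<Sum>x\<in>G. x ^ l * cnj (f x) * (cnj y ^ l * f y)) =
          (\<Sum>u\<in>G. (u * y) ^ l * cnj (f (u * y)) * (cnj y ^ l * f y))"
        using y y0 by (intro sum.reindex_bij_witness[of _ "\<lambda>u. u * y" "\<lambda>x. x / y"])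
          (auto simp: G_def power_mult_distrib power_divide)
      also have "\<dots> = (\<Sum>u\<in>G. (y * cnj y) ^ l * (u ^ l * (cnj (f (u * y)) * f y)))"
        by (simp add: power_mult_distrib mult_ac)
      finally show "(\<Sum>x\<in>G. x ^ l * cnj (f x) * (cnj y ^ l * f y)) =
          (\<Sum>u\<in>G. u ^ l * (cnj (f (u * y)) * f y))"
        by (simp add: yy)
    qed
    also have "\<dots> = (\<Sum>u\<in>G. u ^ l * D u)"
      by (subst sum.swap) (simp add: D_def sum_distrib_left)
    finally have "(norm (S l))\<^sup>2 = norm (\<Sum>u\<in>G. u ^ l * D u)"
      by (metis norm_of_real abs_of_nonneg zero_le_power2)
    also have "\<dots> \<le> (\<Sum>u\<in>G. norm (D u))"
      by (rule order_trans[OF norm_sum]) (simp add: norm_mult norm_power normG)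
    finally show ?thesis .
  qed
  \<comment> \<open>\<open>R\<close> is the uniform bound on the \<open>S l\<close> that
    Cauchy-Schwarz gives for the sum of the \<open>norm (D u)\<close>.\<close>
  define R where "R = root 4 (Q * W)"
  have R: "R ^ 4 = Q * W" "R \<ge> 0"
    using W0 by (auto simp: R_def)
  have SR: "norm (S l) \<le> R" for l
  proof -
    have "norm (S l) ^ 4 = ((norm (S l))\<^sup>2)\<^sup>2"
      by (simp flip: power_mult)
    also have "\<dots> \<le> (\<Sum>u\<in>G. norm (D u))\<^sup>2"
      by (intro power_mono S2) auto
    also have "\<dots> \<le> Q * W"
      using sum_squared_le_sum_of_squares[of "\<lambda>u. norm (D u)" G]
      by (simp add: W_def cardG mult.commute)
    finally have "norm (S l) ^ 4 \<le> R ^ 4" by (simp add: R)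
    then show ?thesis using R(2) power_mono_iff[of "norm (S l)" R 4] by simp
  qed
  \<comment> \<open>Pair the series of \<open>f\<close> with \<open>cnj (f x)\<close> over
    \<open>G\<close>. As \<open>f\<close> is unimodular there, the total is \<open>Q\<close>, and it
    is also the sum of \<open>c k * S (d k)\<close>, hence at most \<open>K * R\<close>.\<close>
  have "((\<lambda>k. \<Sum>x\<in>G. c k * x ^ d k * cnj (f x)) has_sum (\<Sum>x\<in>G. f x * cnj (f x))) UNIV"
    by (intro has_sum_sum has_sum_cmult_left f finG)
  also have "(\<Sum>x\<in>G. f x * cnj (f x)) = of_nat Q"
    using unimod by (simp add: complex_norm_square[symmetric] cardG)
  finally have "((\<lambda>k. c k * S (d k)) has_sum of_nat Q) UNIV"
    by (simp add: S_def sum_distrib_left mult.assoc)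
  then have "norm (of_nat Q :: complex) \<le> (\<Sum>\<^sub>\<infinity>k. norm (c k)) * R"
    by (rule norm_infsum_le[OF _ has_sum_cmult_left[OF has_sum_infsum[OF summ]]])
       (simp add: norm_mult SR mult_left_mono)
  also have "\<dots> \<le> K * R"
    using R(2) le by (intro mult_right_mono) auto
  finally have "real Q ^ 4 \<le> (K * R) ^ 4"
    by (intro power_mono) auto
  then have "real Q * real Q ^ 3 \<le> real Q * (K ^ 4 * W)"
    by (simp add: power_mult_distrib R(1) mult_ac flip: power_Suc)
  then show ?thesis
    using Q by (simp add: W_def D_def)
qed

text \<open>The mean over \<open>n\<close> of the fourth moments of \<open>disc_moebius a ^ n\<close> on the \<open>Q\<close>-th roots of unity
  tends to the number of solutions of \<open>B (u y) B v = B y B (u v)\<close> with \<open>B = disc_moebius a\<close>,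
  which is only \<open>O(Q\<^sup>2)\<close> unless \<open>a = 0\<close>.\<close>
lemma moebius_powers_bounded_imp_zero:
  fixes c :: "nat \<Rightarrow> 'b \<Rightarrow> complex" and d :: "'b \<Rightarrow> nat"
  assumes a: "norm a < 1"
    and summ: "\<And>n. (\<lambda>k. norm (c n k)) summable_on UNIV"
    and le: "\<And>n. (\<Sum>\<^sub>\<infinity>k. norm (c n k)) \<le> K"
    and f: "\<And>n x. norm x = 1 \<Longrightarrow> ((\<lambda>k. c n k * x ^ d k) has_sum disc_moebius a x ^ n) UNIV"
  shows "a = 0"
proof (rule ccontr)
  assume a0: "a \<noteq> 0"
  \<comment> \<open>Chosen to violate the inequality \<open>real Q \<le> 3 * K ^ 4\<close> reached
    at the end.\<close>
  obtain Q :: nat where Q: "real Q > 3 * K ^ 4" "Q > 0"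
    using reals_Archimedean2[of "max 1 (3 * K ^ 4)"] by auto
  define G where "G = {x::complex. x ^ Q = 1}"
  have finG: "finite G" and cardG: "card G = Q"
    using Q by (auto simp: G_def card_roots_unity_eq intro!: finite_roots_unity)
  have normG: "norm x = 1" if "x \<in> G" for x
    using that Q norm_root_of_unity[of x Q] by (simp add: G_def)
  have Gmult: "x * y \<in> G" if "x \<in> G" "y \<in> G" for x y
    using that by (simp add: G_def power_mult_distrib)
  let ?B = "disc_moebius a"
  have BG: "norm (?B x) = 1" if "x \<in> G" for x
    using norm_moebius_eq_1[OF a normG[OF that]] .
  \<comment> \<open>Expanding the squares in \<open>W n\<close> gives a sum over triples in which
    \<open>n\<close> enters only as the exponent of the unimodular number
    \<open>w t\<close>.\<close>
  define T where "T = G \<times> G \<times> G"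
  define w where "w = (\<lambda>(u, y, v). cnj (?B (u * y)) * ?B y * (?B (u * v) * cnj (?B v)))"
  define W where "W n = (\<Sum>u\<in>G. (norm (\<Sum>y\<in>G. cnj (?B (u * y) ^ n) * ?B y ^ n))\<^sup>2)" for n
  have finT: "finite T" by (simp add: T_def finG)
  have W: "complex_of_real (W n) = (\<Sum>t\<in>T. w t ^ n)" for n
  proof -
    have "complex_of_real (W n) = (\<Sum>u\<in>G. \<Sum>y\<in>G. \<Sum>v\<in>G.
        cnj (?B (u * y) ^ n) * ?B y ^ n * cnj (cnj (?B (u * v) ^ n) * ?B v ^ n))"
      unfolding W_def of_real_sum complex_norm_square cnj_sum sum_product ..
    also have "\<dots> = (\<Sum>t\<in>T. w t ^ n)"
      by (simp add: T_def w_def sum.cartesian_product power_mult_distrib case_prod_unfold)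
    finally show ?thesis .
  qed
  have lower: "real Q ^ 3 \<le> K ^ 4 * W n" for n
    unfolding W_def
    by (rule fourth_moment_lower_bound[OF Q(2) G_def _ summ[of n] le, where d = d])
       (use BG normG f in \<open>auto simp: norm_power\<close>)
  have wnorm: "norm (w t) = 1" if "t \<in> T" for t
    using that by (auto simp: T_def w_def norm_mult BG Gmult)
  define E where "E = {t \<in> T. w t = 1}"
  \<comment> \<open>Averaging over \<open>n\<close> keeps exactly the triples with
    \<open>w t = 1\<close>, so the limit counts \<open>E\<close>.\<close>
  have "(\<lambda>N. \<Sum>t\<in>T. (\<Sum>n<N. w t ^ n) / of_nat N) \<longlonglongrightarrow> (\<Sum>t\<in>T. if w t = 1 then 1 else 0)"
    by (intro tendsto_sum power_mean_tendsto wnorm)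
  also have "(\<Sum>t\<in>T. if w t = 1 then 1 else 0) = (of_nat (card E) :: complex)"
    using finT by (simp add: E_def sum.If_cases Int_def)
  also have "(\<lambda>N. \<Sum>t\<in>T. (\<Sum>n<N. w t ^ n) / of_nat N) =
      (\<lambda>N. complex_of_real ((\<Sum>n<N. W n) / real N))"
    by (simp add: W sum.swap[of _ T] flip: sum_divide_distrib)
  finally have lim: "(\<lambda>N. (\<Sum>n<N. W n) / real N) \<longlonglongrightarrow> real (card E)"
    using tendsto_of_real_iff[of "\<lambda>N. (\<Sum>n<N. W n) / real N" "real (card E)" sequentially,
        where 'a = complex] by simp
  have "real Q ^ 3 \<le> K ^ 4 * real (card E)"
  proof (rule LIMSEQ_le_const[OF tendsto_mult_left[OF lim]], intro exI allI impI)
    fix N :: nat assume N: "1 \<le> N"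
    have "real N * real Q ^ 3 \<le> (\<Sum>n<N. K ^ 4 * W n)"
      using sum_mono[of "{..<N}" "\<lambda>_. real Q ^ 3", OF lower] by simp
    then show "real Q ^ 3 \<le> K ^ 4 * ((\<Sum>n<N. W n) / real N)"
      using N by (simp add: field_simps flip: sum_distrib_left sum_distrib_right)
  qed
  also have "card E \<le> 3 * Q\<^sup>2"
  proof -
    \<comment> \<open>The three alternatives of \<open>moebius_mult_eq_cases\<close>:
      \<open>u = 1\<close>, \<open>v = y\<close>, or \<open>v\<close> determined by \<open>u\<close>
      and \<open>y\<close>. Each leaves two free parameters in \<open>G\<close>.\<close>
    define E1 E2 E3 where "E1 = {1::complex} \<times> G \<times> G"
      and "E2 = (\<lambda>(u, y). (u, y, y)) ` (G \<times> G)"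
      and "E3 = (\<lambda>(u, y). (u, y, a / (cnj a * (u * y)))) ` (G \<times> G)"
    have "E \<subseteq> E1 \<union> (E2 \<union> E3)"
    proof
      fix t assume "t \<in> E"
      then obtain u y v where t: "t = (u, y, v)" and uyv: "u \<in> G" "y \<in> G" "v \<in> G"
        and w1: "w (u, y, v) = 1"
        by (auto simp: E_def T_def)
      have nz: "u \<noteq> 0" "y \<noteq> 0" using uyv normG by force+
      have cB: "?B x * cnj (?B x) = 1" if "x \<in> G" for x
        using BG[OF that] by (simp flip: complex_norm_square)
      \<comment> \<open>Inserting the factor \<open>w (u, y, v) = 1\<close> and cancelling
        unimodular factors removes the conjugates.\<close>
      have "?B (u * y) * ?B v = ?B (u * y) * ?B v * w (u, y, v)"
        by (simp add: w1)
      also have "\<dots> = (?B (u * y) * cnj (?B (u * y))) * (?B v * cnj (?B v)) * (?B y * ?B (u * v))"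
        by (simp add: w_def mult_ac)
      also have "\<dots> = ?B y * ?B (u * v)"
        by (simp add: cB uyv Gmult)
      finally have "u * y = y \<or> u * y = u * v \<or> cnj a * (u * y * v) = a"
        using uyv by (intro moebius_mult_eq_cases[OF a]) (auto simp: normG Gmult)
      then consider "u = 1" | "v = y" | "v = a / (cnj a * (u * y))"
        using nz a0 by (auto simp: field_simps)
      then show "t \<in> E1 \<union> (E2 \<union> E3)"
        using uyv by cases (auto simp: t E1_def E2_def E3_def)
    qed
    then have "card E \<le> card (E1 \<union> (E2 \<union> E3))"
      by (rule card_mono[rotated]) (auto simp: E1_def E2_def E3_def finG)
    also have "\<dots> \<le> card E1 + (card E2 + card E3)"
      by (rule order_trans[OF card_Un_le add_left_mono[OF card_Un_le]])
    also have "card E1 = Q\<^sup>2"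
      by (simp add: E1_def card_cartesian_product cardG power2_eq_square)
    also have "card E2 \<le> Q\<^sup>2"
      unfolding E2_def by (rule order_trans[OF card_image_le])
        (auto simp: finG card_cartesian_product cardG power2_eq_square)
    also have "card E3 \<le> Q\<^sup>2"
      unfolding E3_def by (rule order_trans[OF card_image_le])
        (auto simp: finG card_cartesian_product cardG power2_eq_square)
    finally show ?thesis by simp
  qed
  finally have "real Q ^ 3 \<le> K ^ 4 * real (3 * Q\<^sup>2)"
    by (simp add: mult_left_mono)
  then have "(real Q)\<^sup>2 * real Q \<le> (real Q)\<^sup>2 * (3 * K ^ 4)"
    by (simp add: power3_eq_cube power2_eq_square algebra_simps)
  then have "real Q \<le> 3 * K ^ 4"
    using Q(2) by simp
  with Q(1) show False by simp
qed

subsection \<open>Composition operators\<close>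

lemma closure_polydisc: "closure polydisc = (cpolydisc :: (complex ^ 'n::finite) set)"
proof
  have "closed (cpolydisc :: (complex ^ 'n) set)"
    unfolding cpolydisc_def by (intro closed_Collect_all closed_Collect_le continuous_intros)
  then show "closure polydisc \<subseteq> (cpolydisc :: (complex ^ 'n) set)"
    by (rule closure_minimal[OF polydisc_subset_cpolydisc])
  show "cpolydisc \<subseteq> closure (polydisc :: (complex ^ 'n) set)"
  proof
    fix z :: "complex ^ 'n" assume z: "z \<in> cpolydisc"
    have "(1 - inverse (real (Suc n))) *\<^sub>R z \<in> polydisc" for n
    proof -
      have "(1 - inverse (real (Suc n))) * norm (z $ i) < 1" for i
      proof -
        have "(1 - inverse (real (Suc n))) * norm (z $ i) \<le> 1 - inverse (real (Suc n))"
          using z by (intro mult_right_le_one_le) (auto simp: cpolydisc_def field_simps)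
        also have "\<dots> < 1" by simp
        finally show ?thesis .
      qed
      moreover have "\<bar>1 - inverse (real (Suc n))\<bar> = 1 - inverse (real (Suc n))"
        by (simp add: field_simps)
      ultimately show ?thesis by (simp add: polydisc_def)
    qed
    moreover have "(\<lambda>n. (1 - inverse (real (Suc n))) *\<^sub>R z) \<longlonglongrightarrow> (1 - 0) *\<^sub>R z"
      by (intro tendsto_intros LIMSEQ_inverse_real_of_nat)
    ultimately show "z \<in> closure polydisc"
      unfolding closure_sequential by (metis (no_types, lifting) diff_zero scaleR_one)
  qed
qed

text \<open>Continuity and density settle the closed polydisc, the normalisation the rest. Hence the
  definite description in \<open>comp_op\<close> is well defined.\<close>

lemma Aplus_eqI:
  assumes "f \<in> Aplus" "g \<in> Aplus" "\<And>z. z \<in> polydisc \<Longrightarrow> f z = g z"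
  shows "f = g"
proof
  fix z
  show "f z = g z"
  proof (cases "z \<in> cpolydisc")
    case True
    have "f z - g z = 0"
      by (rule continuous_constant_on_closure[of polydisc])
         (use assms True in \<open>auto simp: closure_polydisc
             intro!: continuous_on_diff[OF continuous_on_Aplus continuous_on_Aplus]\<close>)
    then show ?thesis by simp
  qed (use assms in \<open>auto simp: Aplus_def\<close>)
qed

lemma Aplus_norm_le_1_on_closure:
  assumes "f \<in> Aplus" "\<And>z. z \<in> polydisc \<Longrightarrow> norm (f z) \<le> 1" "z \<in> cpolydisc"
  shows "norm (f z) \<le> 1"
  by (rule continuous_on_closure_norm_le[of polydisc f])
     (use assms in \<open>auto simp: closure_polydisc intro: continuous_on_Aplus\<close>)

lemma comp_op_eqI:
  assumes "g \<in> Aplus" "\<And>z. z \<in> polydisc \<Longrightarrow> g z = f (\<phi> z)"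
  shows "comp_op \<phi> f = g"
  unfolding comp_op_def
  by (rule the_equality) (use assms in \<open>auto intro: Aplus_eqI\<close>)

lemma comp_op_bounded_Aplus:
  assumes "comp_op_bounded \<phi>" "f \<in> Aplus"
  shows comp_op_in_Aplus: "comp_op \<phi> f \<in> Aplus"
    and comp_op_apply: "z \<in> polydisc \<Longrightarrow> comp_op \<phi> f z = f (\<phi> z)"
proof -
  obtain g where g: "g \<in> Aplus" "\<forall>z\<in>polydisc. g z = f (\<phi> z)"
    using assms by (auto simp: comp_op_bounded_def)
  then have "comp_op \<phi> f = g" by (intro comp_op_eqI) auto
  with g show "comp_op \<phi> f \<in> Aplus" "z \<in> polydisc \<Longrightarrow> comp_op \<phi> f z = f (\<phi> z)" by auto
qed

section \<open>Rotations with permuted coordinates give automorphisms\<close>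

lemma Aplus_compose_rotation:
  fixes \<sigma> :: "'n::finite \<Rightarrow> 'n"
  assumes f: "f \<in> Aplus" and \<sigma>: "\<sigma> permutes UNIV" and \<epsilon>: "\<And>i. norm (\<epsilon> i) = 1"
  shows "(\<lambda>z. f (\<chi> i. \<epsilon> i * z $ \<sigma> i)) \<in> Aplus"
proof -
  obtain a where a: "(\<lambda>m. norm (a m)) summable_on UNIV"
    "\<And>z. z \<in> cpolydisc \<Longrightarrow> ((\<lambda>m. a m * monomial_pow m z) has_sum f z) UNIV"
    "\<And>z. z \<notin> cpolydisc \<Longrightarrow> f z = 0"
    using AplusE[OF f] by blast
  have cp: "(\<chi> i. \<epsilon> i * z $ \<sigma> i) \<in> cpolydisc \<longleftrightarrow> z \<in> cpolydisc" for z
    unfolding cpolydisc_def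
    by (simp add: norm_mult \<epsilon>) (metis \<sigma> permutes_inverses(1))
  \<comment> \<open>Multi-indices are only permuted and coefficients change by unimodular factors,
    so absolute summability persists.\<close>
  have mono: "monomial_pow m (\<chi> i. \<epsilon> i * z $ \<sigma> i) =
      (\<Prod>i\<in>UNIV. \<epsilon> i ^ m i) * monomial_pow (m \<circ> inv \<sigma>) z" for m z
  proof -
    have "(\<Prod>i\<in>UNIV. (z $ \<sigma> i) ^ m i) = (\<Prod>i\<in>UNIV. (z $ i) ^ m (inv \<sigma> i))"
      using prod.permute[OF \<sigma>, of "\<lambda>i. (z $ i) ^ m (inv \<sigma> i)"]
      by (simp add: o_def permutes_inverses[OF \<sigma>])
    then show ?thesis
      by (simp add: monomial_pow_def power_mult_distrib prod.distrib)
  qed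
  show ?thesis
  proof (rule Aplus_familyI[where c = "\<lambda>m. a m * (\<Prod>i\<in>UNIV. \<epsilon> i ^ m i)" and d = "\<lambda>m. m \<circ> inv \<sigma>"])
    show "(\<lambda>m. norm (a m * (\<Prod>i\<in>UNIV. \<epsilon> i ^ m i))) summable_on UNIV"
      using a(1) by (simp add: norm_mult norm_power \<epsilon> flip: prod_norm)
    show "((\<lambda>m. a m * (\<Prod>i\<in>UNIV. \<epsilon> i ^ m i) * monomial_pow (m \<circ> inv \<sigma>) z) has_sum
        f (\<chi> i. \<epsilon> i * z $ \<sigma> i)) UNIV" if "z \<in> cpolydisc" for z
      using a(2)[of "\<chi> i. \<epsilon> i * z $ \<sigma> i"] that by (simp add: cp mono mult.assoc)
  qed (use a(3) cp in auto)
qed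

text \<open>On the algebra the operator is composition with the linear map \<open>R\<close> at every
  point, so it respects the operations, and composition with the inverse map \<open>R'\<close>
  undoes it.\<close>

lemma rotation_imp_automorphism:
  fixes \<sigma> :: "'n::finite \<Rightarrow> 'n"
  assumes \<sigma>: "\<sigma> permutes UNIV" and \<epsilon>: "\<And>i. norm (\<epsilon> i) = 1"
    and \<phi>: "\<And>z. z \<in> polydisc \<Longrightarrow> \<phi> z = (\<chi> i. \<epsilon> i * z $ \<sigma> i)"
  shows "Aplus_automorphism (comp_op \<phi>)"
proof -
  define R where "R z = (\<chi> i. \<epsilon> i * z $ \<sigma> i)" for z
  define \<epsilon>' where "\<epsilon>' i = inverse (\<epsilon> (inv \<sigma> i))" for i
  define R' where "R' z = (\<chi> i. \<epsilon>' i * z $ inv \<sigma> i)" for z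
  have [simp]: "\<epsilon> i \<noteq> 0" for i using \<epsilon>[of i] by auto
  have RR: "R (R' z) = z" "R' (R z) = z" for z
    by (simp_all add: R_def R'_def \<epsilon>'_def vec_eq_iff permutes_inverses[OF \<sigma>])
  have T: "comp_op \<phi> f = (\<lambda>z. f (R z))" if "f \<in> Aplus" for f
    by (rule comp_op_eqI)
       (use Aplus_compose_rotation[OF that \<sigma> \<epsilon>] in \<open>auto simp: R_def \<phi>\<close>)
  have R: "(\<lambda>z. f (R z)) \<in> Aplus" if "f \<in> Aplus" for f
    using Aplus_compose_rotation[OF that \<sigma> \<epsilon>] by (simp add: R_def)
  have R': "(\<lambda>z. f (R' z)) \<in> Aplus" if "f \<in> Aplus" for f
    unfolding R'_def
    by (rule Aplus_compose_rotation[OF that permutes_inv[OF \<sigma>]]) (simp add: \<epsilon>'_def norm_inverse \<epsilon>)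
  have "bij_betw (comp_op \<phi>) Aplus Aplus"
    by (rule bij_betwI[where g = "\<lambda>f z. f (R' z)"]) (auto simp: T R R' RR)
  moreover have "comp_op \<phi> Aplus_one = Aplus_one"
    unfolding T[OF Aplus_one_in_Aplus]
  proof
    fix z
    have "R z \<in> cpolydisc \<longleftrightarrow> z \<in> cpolydisc"
      unfolding cpolydisc_def R_def
      by (simp add: norm_mult \<epsilon>) (metis \<sigma> permutes_inverses(1))
    then show "Aplus_one (R z) = Aplus_one z" by (simp add: Aplus_one_def)
  qed
  ultimately show ?thesis
    by (simp add: Aplus_automorphism_def T Aplus_add Aplus_cmult Aplus_mult)
qed

subsection \<open>Automorphisms\<close>

lemma holomorphic_norm_le_1_constant:
  assumes "f holomorphic_on ball 0 1" "\<And>z. norm z < 1 \<Longrightarrow> norm (f z) \<le> 1"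
    and "norm \<xi> < 1" "norm (f \<xi>) = 1" "norm z < 1"
  shows "f z = f \<xi>"
proof -
  have "f constant_on ball 0 1"
    by (rule maximum_modulus_principle[where U = "ball 0 1" and \<xi> = \<xi>]) (use assms in auto)
  then show ?thesis using assms by (auto simp: constant_on_def)
qed

text \<open>Supplies the strict bound for the Schwarz lemma: a value of modulus 1 would force a
  constant, against \<open>f 0 = 0\<close>.\<close>

lemma holomorphic_norm_less_1:
  assumes "f holomorphic_on ball 0 1" "\<And>z. norm z < 1 \<Longrightarrow> norm (f z) \<le> 1" "f 0 = 0"
    and "norm z < 1"
  shows "norm (f z) < 1"
  using holomorphic_norm_le_1_constant[OF assms(1,2), of z 0] assms(2)[of z] assms(3,4)
  by (cases "norm (f z) = 1") auto

text \<open>\<open>g\<close> is the preimage of a coordinate function. If it took a value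
  \<open>l\<close> of modulus above 1 at \<open>w\<close>, then \<open>l - g\<close> would vanish at
  \<open>w\<close> and yet be inverted by the preimage of the resolvent.\<close>

lemma automorphism_left_inverse:
  fixes \<phi> :: "complex ^ 'n::finite \<Rightarrow> complex ^ 'n"
  assumes bdd: "comp_op_bounded \<phi>" and aut: "Aplus_automorphism (comp_op \<phi>)"
  obtains g where "g \<in> Aplus" "\<And>z. z \<in> polydisc \<Longrightarrow> g (\<phi> z) = z $ i"
    and "\<And>w. w \<in> cpolydisc \<Longrightarrow> norm (g w) \<le> 1"
proof -
  let ?T = "comp_op \<phi>"
  have bij: "bij_betw ?T Aplus Aplus"
    using aut by (simp add: Aplus_automorphism_def)
  have surj: "\<exists>g\<in>Aplus. ?T g = f" if "f \<in> Aplus" for f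
    using bij that by (metis bij_betw_iff_bijections)
  obtain g where g: "g \<in> Aplus" "?T g = Aplus_monomial i 1"
    using surj[of "Aplus_monomial i 1"] by auto
  have gz: "g (\<phi> z) = z $ i" if "z \<in> polydisc" for z
    using comp_op_apply[OF bdd g(1) that] that polydisc_subset_cpolydisc g(2)
    by (auto simp: Aplus_monomial_def)
  have "norm (g w) \<le> 1" if w: "w \<in> cpolydisc" for w
  proof (rule ccontr)
    assume neg: "\<not> norm (g w) \<le> 1"
    define l where "l = g w"
    have l: "norm l > 1" using neg by (simp add: l_def)
    obtain h where h: "h \<in> Aplus" "?T h = (\<lambda>z. if z \<in> cpolydisc then inverse (l - z $ i) else 0)"
      using surj[OF Aplus_resolvent[OF l, of i]] by auto
    define k where "k z = (l * Aplus_one z + (-1) * g z) * h z" for z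
    have k: "k \<in> Aplus"
      unfolding k_def by (intro Aplus_mult Aplus_add Aplus_cmult g h Aplus_one_in_Aplus)
    have "k = Aplus_one"
    proof (rule inj_onD[OF bij_betw_imp_inj_on[OF bij] _ k Aplus_one_in_Aplus])
      have "?T k = Aplus_one"
      proof (rule Aplus_eqI[OF comp_op_in_Aplus[OF bdd k] Aplus_one_in_Aplus])
        fix z :: "complex ^ 'n" assume z: "z \<in> polydisc"
        then have zc: "z \<in> cpolydisc" using polydisc_subset_cpolydisc by auto
        \<comment> \<open>Both sides are values at \<open>z\<close> of the image of the unit, which
          the automorphism fixes.\<close>
        have "Aplus_one (\<phi> z) = Aplus_one z"
          using comp_op_apply[OF bdd Aplus_one_in_Aplus z] aut by (simp add: Aplus_automorphism_def)
        moreover have "Aplus_one z = 1" using zc by (simp add: Aplus_one_def)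
        ultimately have one: "Aplus_one (\<phi> z) = 1" "Aplus_one z = 1" by simp_all
        have "h (\<phi> z) = inverse (l - z $ i)"
          using comp_op_apply[OF bdd h(1) z] zc by (simp add: h(2))
        moreover have "l - z $ i \<noteq> 0"
          using l zc unfolding cpolydisc_def by (metis (mono_tags) mem_Collect_eq eq_iff_diff_eq_0 not_le)
        ultimately show "?T k z = Aplus_one z"
          by (simp add: comp_op_apply[OF bdd k z] k_def one gz[OF z])
      qed
      then show "?T k = ?T Aplus_one"
        using aut by (simp add: Aplus_automorphism_def)
    qed
    then have "k w = 1" using w by (simp add: Aplus_one_def)
    then show False using w by (simp add: k_def l_def Aplus_one_def)
  qed
  with g(1) gz that show ?thesis by blast
qed

lemma comp_op_coordinate:
  assumes "\<forall>z\<in>polydisc. \<phi> z \<in> cpolydisc" "comp_op_bounded \<phi>" "z \<in> polydisc"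
  shows "comp_op \<phi> (Aplus_monomial j n) z = (\<phi> z $ j) ^ n"
  using comp_op_apply[OF assms(2) Aplus_monomial_in_Aplus assms(3)] assms(1,3)
  by (simp add: Aplus_monomial_def)

text \<open>Makes \<open>z\<close> the interior point at parameter \<open>1 / r\<close> of a disc
  through 0 that stays in the closed polydisc. The \<open>1/2\<close> in the maximum keeps
  \<open>M\<close> positive when \<open>z = 0\<close>.\<close>

lemma polydisc_expand:
  fixes z :: "complex ^ 'n::finite"
  assumes "z \<in> polydisc"
  obtains r :: real where "r > 1" "\<And>i. r * norm (z $ i) \<le> 1"
proof -
  define M where "M = Max (insert (1/2) (range (\<lambda>i. norm (z $ i))))"
  have "M < 1" "M \<ge> 1/2" using assms by (auto simp: M_def polydisc_def Max_less_iff)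
  moreover have "norm (z $ i) \<le> M" for i unfolding M_def by (intro Max_ge) auto
  ultimately show ?thesis
    by (intro that[of "1 / M"]) (auto simp: field_simps)
qed

text \<open>A component of modulus 1 at 0 would be constant by the maximum principle on discs
  through 0. Then a coordinate function and a constant would have the same image, against
  injectivity.\<close>

lemma automorphism_norm_zero_less_1:
  fixes \<phi> :: "complex ^ 'n::finite \<Rightarrow> complex ^ 'n"
  assumes maps: "\<forall>z\<in>polydisc. \<phi> z \<in> cpolydisc" and bdd: "comp_op_bounded \<phi>"
    and aut: "Aplus_automorphism (comp_op \<phi>)"
  shows "norm (\<phi> 0 $ j) < 1"
proof (rule ccontr)
  let ?T = "comp_op \<phi>"
  define c where "c = \<phi> 0 $ j"
  assume "\<not> norm (\<phi> 0 $ j) < 1"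
  moreover have "norm (\<phi> 0 $ j) \<le> 1"
    using maps by (auto simp: cpolydisc_def)
  ultimately have c: "norm c = 1" by (simp add: c_def)
  define F where "F = ?T (Aplus_monomial j 1)"
  have F: "F \<in> Aplus" unfolding F_def by (rule comp_op_in_Aplus[OF bdd]) simp
  have F\<phi>: "F z = \<phi> z $ j" if "z \<in> polydisc" for z
    using comp_op_coordinate[OF maps bdd that, of j 1] by (simp add: F_def)
  have F1: "norm (F z) \<le> 1" if "z \<in> cpolydisc" for z
    by (rule Aplus_norm_le_1_on_closure[OF F _ that]) (use maps in \<open>auto simp: F\<phi> cpolydisc_def\<close>)
  have const: "F z = c" if z: "z \<in> polydisc" for z
  proof -
    obtain r where r: "r > 1" "\<And>i. r * norm (z $ i) \<le> 1"
      using polydisc_expand[OF z] by blast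
    define cv where "cv s = (\<chi> i. s * (of_real r * z $ i))" for s
    have cv: "cv s \<in> cpolydisc" if "norm s \<le> 1" for s
      unfolding cpolydisc_def cv_def using mult_le_one[OF that _ r(2)] r(1)
      by (simp add: norm_mult)
    have "F (cv (1 / of_real r)) = F (cv 0)"
    proof (rule holomorphic_norm_le_1_constant[where f = "\<lambda>s. F (cv s)"])
      show "(\<lambda>s. F (cv s)) holomorphic_on ball 0 1"
        by (rule holomorphic_on_Aplus_compose[OF F])
             (auto simp: cv, auto simp: cv_def intro!: holomorphic_intros)
      have "cv 0 = 0" by (simp add: cv_def vec_eq_iff)
      then show "norm (F (cv 0)) = 1" using c by (simp add: F\<phi> c_def)
    qed (use r in \<open>auto simp: cv F1 norm_divide\<close>)
    moreover have "cv (1 / of_real r) = z" "cv 0 = 0"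
      using r by (auto simp: cv_def vec_eq_iff)
    ultimately show ?thesis by (simp add: F\<phi> c_def)
  qed
  have "F = ?T (\<lambda>z. c * Aplus_one z)"
  proof (rule Aplus_eqI[OF F comp_op_in_Aplus[OF bdd Aplus_cmult[OF Aplus_one_in_Aplus]]])
    fix z :: "complex ^ 'n" assume z: "z \<in> polydisc"
    have "?T (\<lambda>z. c * Aplus_one z) z = c * Aplus_one (\<phi> z)"
      by (rule comp_op_apply[OF bdd Aplus_cmult[OF Aplus_one_in_Aplus] z])
    then show "F z = ?T (\<lambda>z. c * Aplus_one z) z"
      using maps z by (simp add: const Aplus_one_def)
  qed
  moreover have "inj_on ?T Aplus"
    using aut by (auto simp: Aplus_automorphism_def bij_betw_def)
  ultimately have "Aplus_monomial j 1 = (\<lambda>z. c * Aplus_one z)"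
    unfolding F_def by (auto dest!: inj_onD intro: Aplus_cmult)
  from fun_cong[OF this, of 0] show False
    using c polydisc_subset_cpolydisc
    by (auto simp: Aplus_monomial_def Aplus_one_def cpolydisc_def)
qed

text \<open>Normalised so that they fix 0, both \<open>\<phi>\<close> and its left inverse \<open>g\<close> are contractions for the
  sup norm by the Schwarz lemma. As \<open>g\<^sub>i\<close> takes \<open>\<phi> (axis i (1/2))\<close> back to \<open>1/2\<close>, some
  component of \<open>\<phi>\<close> attains equality there.\<close>
lemma automorphism_on_axis:
  fixes \<phi> :: "complex ^ 'n::finite \<Rightarrow> complex ^ 'n"
  assumes maps: "\<forall>z\<in>polydisc. \<phi> z \<in> cpolydisc" and bdd: "comp_op_bounded \<phi>"
    and aut: "Aplus_automorphism (comp_op \<phi>)"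
  shows "\<exists>j \<epsilon>. norm \<epsilon> = 1 \<and>
    (\<forall>x. norm x < 1 \<longrightarrow> \<phi> (axis i x) $ j = disc_moebius (- (\<phi> 0 $ j)) (\<epsilon> * x))"
proof -
  define a where "a j = \<phi> 0 $ j" for j
  have a: "norm (a j) < 1" for j
    unfolding a_def by (rule automorphism_norm_zero_less_1[OF maps bdd aut])
  obtain g where g: "g \<in> Aplus" "\<And>z. z \<in> polydisc \<Longrightarrow> g (\<phi> z) = z $ i"
    and g1: "\<And>w. w \<in> cpolydisc \<Longrightarrow> norm (g w) \<le> 1"
    using automorphism_left_inverse[OF bdd aut] by blast
  have axis0: "axis i (0::complex) = 0" by (simp add: axis_def vec_eq_iff)
  have \<phi>1: "norm (\<phi> (axis i x) $ j) \<le> 1" if "norm x < 1" for x j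
    using maps that by (force simp: cpolydisc_def)
  define \<Phi> where "\<Phi> j x = disc_moebius (a j) (\<phi> (axis i x) $ j)" for j x
  have \<Phi>_hol: "\<Phi> j holomorphic_on ball 0 1" for j
  proof -
    have "(\<lambda>x. comp_op \<phi> (Aplus_monomial j 1) (axis i x)) holomorphic_on ball 0 1"
    proof (rule holomorphic_on_Aplus_compose[OF comp_op_in_Aplus[OF bdd]])
      show "(\<lambda>x. axis i x $ l) holomorphic_on ball 0 1" for l
        by (cases "l = i") (auto simp: axis_def)
    qed auto
    then have "(\<lambda>x. \<phi> (axis i x) $ j) holomorphic_on ball 0 1"
      by (rule holomorphic_transform) (simp add: comp_op_coordinate[OF maps bdd])
    then show ?thesis
      unfolding \<Phi>_def by (rule holomorphic_on_moebius[OF a]) (simp add: \<phi>1)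
  qed
  have \<Phi>0: "\<Phi> j 0 = 0" for j by (simp add: \<Phi>_def axis0 a_def)
  have \<Phi>1: "norm (\<Phi> j x) < 1" if "norm x < 1" for j x
    by (rule holomorphic_norm_less_1[OF \<Phi>_hol _ \<Phi>0 that])
       (auto simp: \<Phi>_def intro: norm_moebius_le_1 a \<phi>1)
  have inv: "disc_moebius (- a j) (\<Phi> j x) = \<phi> (axis i x) $ j" if "norm x < 1" for j x
    unfolding \<Phi>_def by (rule moebius_uminus_moebius[OF a \<phi>1[OF that]])
  have "\<exists>j. norm (\<Phi> j (1/2)) \<ge> 1/2"
  proof (rule ccontr)
    assume "\<not> ?thesis"
    then have lt: "norm (\<Phi> j (1/2)) < 1/2" for j by (simp add: not_le)
    \<comment> \<open>The \<open>1/4\<close> keeps \<open>r\<close> positive, so that dividing by it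
      is legitimate.\<close>
    define r where "r = Max (insert (1/4) (range (\<lambda>j. norm (\<Phi> j (1/2)))))"
    have "r < 1/2" unfolding r_def by (subst Max_less_iff) (use lt in auto)
    moreover have "r \<ge> 1/4" unfolding r_def by (intro Max_ge) auto
    ultimately have r: "r < 1/2" "r \<ge> 1/4" by auto
    have rj: "norm (\<Phi> j (1/2)) \<le> r" for j unfolding r_def by (intro Max_ge) auto
    \<comment> \<open>A disc in the closed polydisc that meets \<open>\<phi> 0\<close> at parameter
      0 and \<open>\<phi> (axis i (1/2))\<close> at \<open>r\<close>. The Schwarz lemma for
      \<open>g\<close> along it would give \<open>1/2 \<le> r\<close>.\<close>
    define cv where "cv s = (\<chi> j. disc_moebius (- a j) (s * (\<Phi> j (1/2) / of_real r)))" for s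
    have le1: "norm (s * (\<Phi> j (1/2) / of_real r)) \<le> 1" if "norm s \<le> 1" for s j
      using rj[of j] r that unfolding norm_mult norm_divide by (intro mult_le_one) auto
    have cv: "cv s \<in> cpolydisc" if "norm s \<le> 1" for s
      unfolding cpolydisc_def cv_def using le1[OF that] a by (auto intro!: norm_moebius_le_1)
    have hol: "(\<lambda>s. g (cv s)) holomorphic_on ball 0 1"
    proof (rule holomorphic_on_Aplus_compose[OF g(1)])
      show "(\<lambda>s. cv s $ l) holomorphic_on ball 0 1" for l
        unfolding cv_def vec_lambda_beta
      proof (rule holomorphic_on_moebius)
        show "(\<lambda>s. s * (\<Phi> l (1/2) / of_real r)) holomorphic_on ball 0 1"
          by (intro holomorphic_intros) (use r in auto)
      qed (use a le1 in auto)
    qed (auto simp: cv)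
    have "cv 0 = \<phi> 0" by (simp add: cv_def vec_eq_iff a_def)
    then have g0: "g (cv 0) = 0" using g(2)[of 0] by simp
    have "norm (g (cv (of_real r))) \<le> norm (complex_of_real r)"
      using r by (intro Schwarz_Lemma(1)[OF hol g0] holomorphic_norm_less_1[OF hol _ g0])
        (auto intro!: g1 cv)
    also have "cv (of_real r) = \<phi> (axis i (1/2))"
      using r inv[of "1/2"] by (simp add: cv_def vec_eq_iff)
    also have "g \<dots> = 1/2" using g(2)[of "axis i (1/2)"] by simp
    finally show False using r by simp
  qed
  then obtain j where j: "norm (\<Phi> j (1/2)) \<ge> 1/2" by blast
  have "norm (\<Phi> j (1/2)) \<le> norm (1/2 :: complex)"
    by (rule Schwarz_Lemma(1)[OF \<Phi>_hol \<Phi>0 \<Phi>1]) auto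
  with j have eq: "norm (\<Phi> j (1/2)) = norm (1/2 :: complex)" by simp
  have "\<exists>\<epsilon>. (\<forall>z. norm z < 1 \<longrightarrow> \<Phi> j z = \<epsilon> * z) \<and> norm \<epsilon> = 1"
    by (rule Schwarz_Lemma(3)[OF \<Phi>_hol \<Phi>0 \<Phi>1, of 0])
       (use eq in \<open>auto intro!: exI[of _ "1/2"]\<close>)
  then obtain \<epsilon> where "norm \<epsilon> = 1" "\<And>z. norm z < 1 \<Longrightarrow> \<Phi> j z = \<epsilon> * z" by blast
  with inv[of _ j] show ?thesis
    by (intro exI[of _ j] exI[of _ \<epsilon>]) (auto simp: a_def)
qed

section \<open>From one coordinate axis to the whole polydisc\<close>

lemma continuous_on_axis [continuous_intros]:
  fixes f :: "'a::topological_space \<Rightarrow> complex"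
  assumes "continuous_on S f"
  shows "continuous_on S (\<lambda>x. axis i (f x))"
proof -
  have "continuous_on S (\<lambda>x. if l = i then f x else 0)" for l
    using assms by (cases "l = i") auto
  then show ?thesis
    unfolding axis_def by (rule continuous_on_vec_lambda)
qed

text \<open>The indicator stands as a separate factor so that coefficients can absorb it, leaving a
  series in powers of \<open>x\<close>.\<close>

lemma monomial_pow_axis:
  "monomial_pow m (axis i x) = (if \<forall>l. l \<noteq> i \<longrightarrow> m l = 0 then 1 else 0) * x ^ m i"
proof -
  have "monomial_pow m (axis i x) = x ^ m i * (\<Prod>l\<in>UNIV - {i}. (axis i x $ l) ^ m l)"
    unfolding monomial_pow_def by (subst prod.remove[of _ i]) auto
  also have "(\<Prod>l\<in>UNIV - {i}. (axis i x $ l) ^ m l) = (\<Prod>l\<in>UNIV - {i}. 0 ^ m l)"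
    by (intro prod.cong) (auto simp: axis_def)
  also have "\<dots> = (if \<forall>l. l \<noteq> i \<longrightarrow> m l = 0 then 1 else 0)"
    by (auto simp: power_0_left intro!: prod.neutral)
  finally show ?thesis by simp
qed

lemma automorphism_component:
  fixes \<phi> :: "complex ^ 'n::finite \<Rightarrow> complex ^ 'n"
  assumes maps: "\<forall>z\<in>polydisc. \<phi> z \<in> cpolydisc" and bdd: "comp_op_bounded \<phi>"
    and aut: "Aplus_automorphism (comp_op \<phi>)"
  shows "\<exists>j \<epsilon>. norm \<epsilon> = 1 \<and> (\<forall>z\<in>polydisc. \<phi> z $ j = \<epsilon> * z $ i)"
proof -
  obtain j \<epsilon> where \<epsilon>: "norm \<epsilon> = 1"
    and ax: "\<And>x. norm x < 1 \<Longrightarrow> \<phi> (axis i x) $ j = disc_moebius (- (\<phi> 0 $ j)) (\<epsilon> * x)"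
    using automorphism_on_axis[OF maps bdd aut, of i] by blast
  define a where "a = - (\<phi> 0 $ j)"
  have a: "norm a < 1"
    using automorphism_norm_zero_less_1[OF maps bdd aut, of j] by (simp add: a_def)
  define F where "F n = comp_op \<phi> (Aplus_monomial j n)" for n
  have F: "F n \<in> Aplus" for n unfolding F_def by (rule comp_op_in_Aplus[OF bdd]) simp
  have F\<phi>: "F n z = (\<phi> z $ j) ^ n" if "z \<in> polydisc" for n z
    unfolding F_def by (rule comp_op_coordinate[OF maps bdd that])
  \<comment> \<open>Continuity carries the identity to the unit circle, where the moment argument
    takes place.\<close>
  have F_axis: "F n (axis i x) = disc_moebius a (\<epsilon> * x) ^ n" if x: "norm x \<le> 1" for n x
  proof -
    have "F n (axis i x) - disc_moebius a (\<epsilon> * x) ^ n = 0"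
    proof (rule continuous_constant_on_closure[where S = "ball 0 1" and x = x
          and f = "\<lambda>x. F n (axis i x) - disc_moebius a (\<epsilon> * x) ^ n"])
      show "continuous_on (closure (ball 0 1)) (\<lambda>x. F n (axis i x) - disc_moebius a (\<epsilon> * x) ^ n)"
        unfolding disc_moebius_def using moebius_denom_nonzero[OF a]
        by (intro continuous_intros continuous_on_compose2[OF continuous_on_Aplus[OF F]])
           (auto simp: norm_mult \<epsilon>)
    qed (use x in \<open>auto simp: F\<phi> ax a_def\<close>)
    then show ?thesis by simp
  qed
  have "a = 0"
  proof -
    obtain C where C: "\<And>f. f \<in> Aplus \<Longrightarrow> Aplus_norm (comp_op \<phi> f) \<le> C * Aplus_norm f"
      using bdd by (auto simp: comp_op_bounded_def)
    \<comment> \<open>The \<open>F n\<close> are images of monomials of norm at most 1, so the bound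
      is uniform in \<open>n\<close>; the \<open>+ 1\<close> makes it strict.\<close>
    have "Aplus_norm (F n) < \<bar>C\<bar> + 1" for n
    proof -
      have "Aplus_norm (F n) \<le> C * Aplus_norm (Aplus_monomial j n)"
        unfolding F_def by (rule C) simp
      also have "\<dots> \<le> \<bar>C\<bar> * 1"
        by (intro mult_mono Aplus_norm_monomial_le_1) (auto intro: Aplus_norm_nonneg)
      finally show ?thesis by simp
    qed
    then have "\<exists>b. represents b (F n) \<and> (\<Sum>\<^sub>\<infinity>m. norm (b m)) < \<bar>C\<bar> + 1" for n
      using Aplus_norm_lessE[OF F] by metis
    then obtain b where b: "\<And>n. represents (b n) (F n)"
      "\<And>n. (\<Sum>\<^sub>\<infinity>m. norm (b n m)) < \<bar>C\<bar> + 1"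
      by metis
    have bs: "(\<lambda>m. norm (b n m)) summable_on UNIV" for n
      using b(1) by (simp add: represents_def)
    \<comment> \<open>Coefficients of \<open>F n\<close> on the axis after replacing
      \<open>x\<close> by \<open>inverse \<epsilon> * x\<close>, which turns
      \<open>\<epsilon> * x\<close> into \<open>x\<close>.\<close>
    define c where "c n m = b n m *
      ((if \<forall>l. l \<noteq> i \<longrightarrow> m l = 0 then 1 else 0) * inverse \<epsilon> ^ m i)" for n and m :: "'n \<Rightarrow> nat"
    have cb: "norm (c n m) \<le> norm (b n m)" for n m
      by (simp add: c_def norm_mult norm_power norm_inverse \<epsilon>)
    have cs: "(\<lambda>m. norm (c n m)) summable_on UNIV" for n
      by (rule summable_on_comparison_test[OF bs cb]) auto
    show ?thesis
    proof (rule moebius_powers_bounded_imp_zero[OF a cs])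
      show "(\<Sum>\<^sub>\<infinity>m. norm (c n m)) \<le> \<bar>C\<bar> + 1" for n
        using infsum_mono[OF cs bs cb, of n] b(2)[of n] by linarith
      show "((\<lambda>m. c n m * x ^ m i) has_sum disc_moebius a x ^ n) UNIV" if x: "norm x = 1" for n x
      proof -
        have e0: "\<epsilon> \<noteq> 0" using \<epsilon> by auto
        have "((\<lambda>m. b n m * monomial_pow m (axis i (inverse \<epsilon> * x))) has_sum
            F n (axis i (inverse \<epsilon> * x))) UNIV"
          by (rule represents_has_sum[OF b(1)]) (simp add: norm_mult norm_inverse \<epsilon> x)
        moreover have "F n (axis i (inverse \<epsilon> * x)) = disc_moebius a x ^ n"
          using e0 by (subst F_axis) (auto simp: norm_mult norm_inverse \<epsilon> x mult.assoc [symmetric])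
        ultimately show ?thesis
          by (simp add: monomial_pow_axis c_def power_mult_distrib mult_ac)
      qed
    qed
  qed
  then have F1_axis: "F 1 (axis i x) = \<epsilon> * x" if "norm x \<le> 1" for x
    using F_axis[OF that, of 1] by simp
  have F1_le: "norm (F 1 z) \<le> 1" if "z \<in> cpolydisc" for z
    by (rule Aplus_norm_le_1_on_closure[OF F _ that]) (use maps in \<open>auto simp: F\<phi> cpolydisc_def\<close>)
  have "F 1 z = \<epsilon> * z $ i" if z: "z \<in> polydisc" for z
  proof -
    obtain r where r: "r > 1" "\<And>i. r * norm (z $ i) \<le> 1"
      using polydisc_expand[OF z] by blast
    \<comment> \<open>The \<open>i\<close>-th coordinate is \<open>x\<close>; the others run from 0
      at \<open>s = 0\<close> to those of \<open>z\<close> at \<open>s = 1 / r\<close>.\<close>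
    define P where "P x s = (\<chi> l. if l = i then x else s * (of_real r * z $ l))" for x s
    have P: "P x s \<in> cpolydisc" if "norm x \<le> 1" "norm s \<le> 1" for x s
      unfolding cpolydisc_def P_def using mult_le_one[OF that(2) _ r(2)] r(1) that(1)
      by (simp add: norm_mult)
    define h where "h x = F 1 (P x (1 / of_real r)) - \<epsilon> * x" for x
    have r': "norm (1 / complex_of_real r) < 1" using r by (simp add: norm_divide)
    have bdry: "h x = 0" if x: "norm x = 1" for x
    proof -
      have P0: "P x 0 = axis i x" by (auto simp: P_def axis_def vec_eq_iff)
      \<comment> \<open>On the circle the modulus at \<open>s = 0\<close> is already 1, so the
        function of \<open>s\<close> is constant.\<close>
      have "F 1 (P x (1 / of_real r)) = F 1 (P x 0)"
      proof (rule holomorphic_norm_le_1_constant[where f = "\<lambda>s. F 1 (P x s)"])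
        show "(\<lambda>s. F 1 (P x s)) holomorphic_on ball 0 1"
        proof (rule holomorphic_on_Aplus_compose[OF F])
          show "(\<lambda>s. P x s $ l) holomorphic_on ball 0 1" for l
            unfolding P_def by (cases "l = i") (auto intro!: holomorphic_intros)
        qed (use x in \<open>auto simp: P\<close>)
        show "norm (F 1 (P x 0)) = 1"
          using x by (simp only: P0 F1_axis) (simp add: norm_mult \<epsilon> F1_axis)
      qed (use x r' in \<open>auto intro!: F1_le[simplified] P\<close>)
      then show ?thesis using x by (simp only: P0 h_def) (simp add: F1_axis[simplified])
    qed
    \<comment> \<open>Vanishing on the circle passes to the disc by the maximum principle in
      \<open>x\<close>.\<close>
    have "norm (h (z $ i)) \<le> 0"
    proof (rule maximum_modulus_frontier[of h "ball 0 1"])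
      have "(\<lambda>x. F 1 (P x (1 / of_real r))) holomorphic_on ball 0 1"
      proof (rule holomorphic_on_Aplus_compose[OF F])
        show "(\<lambda>x. P x (1 / of_real r) $ l) holomorphic_on ball 0 1" for l
          unfolding P_def by (cases "l = i") (auto intro!: holomorphic_intros)
      qed (use r' in \<open>auto intro!: P\<close>)
      then show "h holomorphic_on interior (ball 0 1)"
        unfolding h_def by (auto intro!: holomorphic_intros)
      have "continuous_on (cball 0 1) (\<lambda>x. if l = i then x else c)" for l and c :: complex
        by (cases "l = i") auto
      then have "continuous_on (cball 0 1) (\<lambda>x. P x (1 / of_real r))"
        unfolding P_def by (intro continuous_on_vec_lambda)
      then show "continuous_on (closure (ball 0 1)) h"
        unfolding h_def using r'
        by (auto intro!: continuous_intros continuous_on_compose2[OF continuous_on_Aplus[OF F]] P)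
    qed (use z bdry in \<open>auto simp: polydisc_def\<close>)
    moreover have "P (z $ i) (1 / of_real r) = z"
      using r by (auto simp: P_def vec_eq_iff)
    ultimately show ?thesis by (simp add: h_def)
  qed
  then show ?thesis
    using \<epsilon> F\<phi>[of _ 1] by (intro exI[of _ j] exI[of _ \<epsilon>]) auto
qed

theorem theorem11:
  fixes \<phi> :: "complex ^ 'n::finite \<Rightarrow> complex ^ 'n"
  assumes maps: "\<forall>z\<in>polydisc. \<phi> z \<in> cpolydisc"
    and holo: "holomorphic_several \<phi> polydisc"
    and bdd: "comp_op_bounded \<phi>"
  shows "Aplus_automorphism (comp_op \<phi>) \<longleftrightarrow>
    (\<exists>\<sigma> \<epsilon>. \<sigma> permutes (UNIV :: 'n set) \<and> (\<forall>i. norm (\<epsilon> i) = 1) \<and>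
       (\<forall>z\<in>polydisc. \<phi> z = (\<chi> i. \<epsilon> i * z $ \<sigma> i)))"
proof
  assume "Aplus_automorphism (comp_op \<phi>)"
  from automorphism_component[OF maps bdd this]
  obtain \<tau> \<epsilon> where \<epsilon>: "\<And>i. norm (\<epsilon> i) = 1"
    and \<phi>: "\<And>i z. z \<in> polydisc \<Longrightarrow> \<phi> z $ \<tau> i = \<epsilon> i * z $ i"
    by metis
  have "inj \<tau>"
  proof (rule injI, rule ccontr)
    fix i i' assume eq: "\<tau> i = \<tau> i'" and ne: "i \<noteq> i'"
    \<comment> \<open>At this point the shared component would be both
      \<open>\<epsilon> i / 2\<close> and 0.\<close>
    have "axis i (1/2) \<in> polydisc" by simp
    from \<phi>[OF this, of i] \<phi>[OF this, of i'] have "\<epsilon> i * (1/2) = 0"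
      using eq ne by (simp add: axis_def)
    then show False using \<epsilon>[of i] by auto
  qed
  then have bij: "bij \<tau>" by (simp add: finite_UNIV_inj_surj bij_def)
  show "\<exists>\<sigma> \<epsilon>. \<sigma> permutes (UNIV :: 'n set) \<and> (\<forall>i. norm (\<epsilon> i) = 1) \<and>
      (\<forall>z\<in>polydisc. \<phi> z = (\<chi> i. \<epsilon> i * z $ \<sigma> i))"
  proof (intro exI[of _ "inv \<tau>"] exI[of _ "\<lambda>j. \<epsilon> (inv \<tau> j)"] conjI allI ballI)
    show "inv \<tau> permutes UNIV" using bij_imp_bij_inv[OF bij] by (intro bij_imp_permutes) auto
    show "\<phi> z = (\<chi> j. \<epsilon> (inv \<tau> j) * z $ inv \<tau> j)" if "z \<in> polydisc" for z
      using \<phi>[OF that, of "inv \<tau> _"] bij by (simp add: vec_eq_iff surj_f_inv_f bij_is_surj)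
  qed (simp add: \<epsilon>)
next
  assume "\<exists>\<sigma> \<epsilon>. \<sigma> permutes (UNIV :: 'n set) \<and> (\<forall>i. norm (\<epsilon> i) = 1) \<and>
      (\<forall>z\<in>polydisc. \<phi> z = (\<chi> i. \<epsilon> i * z $ \<sigma> i))"
  then show "Aplus_automorphism (comp_op \<phi>)"
    using rotation_imp_automorphism by blast
qed

end
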